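(* Let $t$ be an indeterminate and let the rational functions $\tau_n(t)$ be defined by $\tau_0(t)=1+t$, $\tau_{2n}(t)=\frac{1+t^{n+1}}{1+t^n}$ for $n>0$, and $\tau_{2n+1}(t)=\frac{t(1+t^n)}{1+t^{n+1}}$ for $n\ge 0$. Define polynomials $L_n(x,t)$ in $x$ (with coefficients rational in $t$) by $L_0(x,t)=1$, $L_1(x,t)=x$ and $L_n(x,t)=xL_{n-1}(x,t)-\tau_{n-2}(t)L_{n-2}(x,t)$ for $n\ge 2$, and set $S_n(x,t)=\frac{L_{2n+1}(\sqrt{x},t)}{\sqrt{x}}$. Then for every $n\ge 0$, $$S_n(x,t)=\frac{1}{1+t^n}\sum_{k=0}^n(-1)^{n-k}G_{n,k}(t)\,x^k,$$ where $$G_{n,k}(t)=\sum_{j=0}^{n-k}\frac{\binom{j+k}{k}\binom{n-j-1}{k-1}\,\bigl(n(k+1)-j\bigr)}{k(k+1)}\bigl(t^j+t^{2n-k-j}\bigr)\quad\text{for }1\le k\le n,$$ and $$G_{n,0}(t)=(2n+1)t^n+\sum_{j=0}^{2n}t^j.$$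
   Context: Since only odd-index $L$'s are involved, $L_{2n+1}(x,t)$ is $x$ times a polynomial in $x^2$, so $S_n(x,t)$ is a polynomial in $x$ of degree $n$. *)

theory Defs
  imports
    "HOL-Computational_Algebra.Polynomial"
    "HOL-Computational_Algebra.Fraction_Field"
begin

type_synonym ratfun = "rat poly fract"

definition tvar :: ratfun where
  "tvar = Fract [:0, 1:] 1"

definition tau :: "nat \<Rightarrow> ratfun" where
  "tau m =
     (let n = m div 2 in
      if m = 0 then 1 + tvar
      else if even m then (1 + tvar ^ (n + 1)) / (1 + tvar ^ n)
      else tvar * (1 + tvar ^ n) / (1 + tvar ^ (n + 1)))"

fun L :: "nat \<Rightarrow> ratfun poly" where
  "L 0 = 1"
| "L (Suc 0) = [:0, 1:]"
| "L (Suc (Suc n)) = [:0, 1:] * L (Suc n) - smult (tau n) (L n)"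

text \<open>
  With \<open>y\<close> for the square root of \<open>x\<close>, the equation
  \<open>S\<^sub>n(x) = L\<^sub>2\<^sub>n\<^sub>+\<^sub>1(y) / y\<close> is an identity in the polynomial ring in \<open>y\<close>: it says
  \<open>y S\<^sub>n(y\<^sup>2) = L\<^sub>2\<^sub>n\<^sub>+\<^sub>1(y)\<close>. Lemma \<open>S_unique_existence\<close> shows that it determines \<open>S\<^sub>n\<close>.
\<close>

definition S :: "nat \<Rightarrow> ratfun poly" where
  "S n = (THE p. [:0, 1:] * pcompose p ([:0, 1:] ^ 2) = L (2 * n + 1))"

lemma S_unique_existence:
  "\<exists>!p. [:0, 1:] * pcompose p ([:0, 1:] ^ 2) = L (2 * n + 1)"
proof -
  let ?X = "[:0, 1:] :: ratfun poly"
  have X2: "?X ^ 2 = [:0, 0, 1:]"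
    by (simp add: power2_eq_square)
  have ex: "(\<exists>q. pcompose q (?X ^ 2) = L (2 * n)) \<and>
            (\<exists>p. ?X * pcompose p (?X ^ 2) = L (2 * n + 1))"
  proof (induction n)
    case 0
    have "pcompose 1 (?X ^ 2) = L (2 * 0)"
      by (simp add: pcompose_1)
    moreover have "?X * pcompose 1 (?X ^ 2) = L (2 * 0 + 1)"
      by (simp add: pcompose_1)
    ultimately show ?case by blast
  next
    case (Suc n)
    then obtain p q
      where q: "pcompose q (?X ^ 2) = L (2 * n)"
        and p: "?X * pcompose p (?X ^ 2) = L (2 * n + 1)"
      by blast
    define q' where "q' = ?X * p - smult (tau (2 * n)) q"
    define p' where "p' = q' - smult (tau (2 * n + 1)) p"
    have X: "pcompose ?X (?X ^ 2) = ?X ^ 2"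
      by (simp add: pcompose_pCons)
    have "pcompose q' (?X ^ 2) = ?X * (?X * pcompose p (?X ^ 2)) - smult (tau (2 * n)) (pcompose q (?X ^ 2))"
      unfolding q'_def pcompose_diff pcompose_mult pcompose_smult X
      by (simp only: power2_eq_square mult.assoc)
    also have "\<dots> = L (2 * Suc n)"
      unfolding p q by simp
    finally have q': "pcompose q' (?X ^ 2) = L (2 * Suc n)" .
    have "?X * pcompose p' (?X ^ 2) =
        ?X * pcompose q' (?X ^ 2) - smult (tau (2 * n + 1)) (?X * pcompose p (?X ^ 2))"
      unfolding p'_def pcompose_diff pcompose_smult
      by (simp only: right_diff_distrib mult_smult_right)
    also have "\<dots> = L (2 * Suc n + 1)"
      unfolding p q' by simp
    finally show ?case using q' by blast
  qed
  have uniq: "p = q"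
    if "?X * pcompose p (?X ^ 2) = ?X * pcompose q (?X ^ 2)" for p q
  proof -
    have "pcompose p (?X ^ 2) = pcompose q (?X ^ 2)"
      using that by (metis mult_left_cancel pCons_eq_0_iff zero_neq_one)
    then have "pcompose (p - q) (?X ^ 2) = 0"
      by (simp only: pcompose_diff diff_self)
    then have "p - q = 0"
      by (rule pcompose_eq_0) (simp add: X2)
    then show ?thesis by simp
  qed
  show ?thesis
    using ex uniq by (metis (no_types, lifting))
qed

definition G :: "nat \<Rightarrow> nat \<Rightarrow> ratfun" where
  "G n k =
     (if k = 0 then of_nat (2 * n + 1) * tvar ^ n + (\<Sum>j\<le>2 * n. tvar ^ j)
      else \<Sum>j=0..n - k.
        of_nat ((j + k) choose k) * of_nat ((n - j - 1) choose (k - 1))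
          * (of_nat n * (of_nat k + 1) - of_nat j) / (of_nat k * (of_nat k + 1))
          * (tvar ^ j + tvar ^ (2 * n - k - j)))"

end

theory Submission
  imports Defs "HOL-Computational_Algebra.Formal_Power_Series"
begin

text \<open>
  Put \<open>w\<^sub>n = 1 + t\<^sup>n\<close>. Since \<open>\<tau>\<^sub>2\<^sub>n\<^sub>+\<^sub>1 + \<tau>\<^sub>2\<^sub>n\<^sub>+\<^sub>2 = 1 + t\<close> and, for \<open>n > 0\<close>, \<open>\<tau>\<^sub>2\<^sub>n \<tau>\<^sub>2\<^sub>n\<^sub>+\<^sub>1 = t\<close>, contracting
  the recurrence of \<open>L\<close> to even indices gives constant coefficients: \<open>L\<^sub>2\<^sub>n(y) = V\<^sub>n(y\<^sup>2)\<close> for \<open>n > 0\<close>,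
  where \<open>V\<^sub>0 = 2\<close>, \<open>V\<^sub>1 = x - 1 - t\<close> and \<open>V\<^sub>n\<^sub>+\<^sub>2 = (x - 1 - t) V\<^sub>n\<^sub>+\<^sub>1 - t V\<^sub>n\<close>. The recurrence
  \<open>y L\<^sub>2\<^sub>n\<^sub>+\<^sub>1 = L\<^sub>2\<^sub>n\<^sub>+\<^sub>2 + \<tau>\<^sub>2\<^sub>n L\<^sub>2\<^sub>n\<close> then reads \<open>x w\<^sub>n S\<^sub>n = w\<^sub>n V\<^sub>n\<^sub>+\<^sub>1 + w\<^sub>n\<^sub>+\<^sub>1 V\<^sub>n\<close>.

  To find the coefficients of \<open>V\<^sub>n\<close>, replace \<open>(1, t)\<close> by two symmetric parameters \<open>(a, b)\<close> and put
  \<open>D = (1 - a s)(1 - b s)\<close>, \<open>K = s / D\<close> and \<open>F\<^sub>k = \<Sum>\<^sub>n (-1)\<^sup>n\<^sup>+\<^sup>k [x\<^sup>k] V\<^sub>n s\<^sup>n\<close>. The recurrence of \<open>V\<close> gives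
  \<open>D F\<^sub>1 = s (F\<^sub>0 - 1) = s D K'\<close> and \<open>D F\<^sub>k\<^sub>+\<^sub>1 = s F\<^sub>k\<close> for \<open>k > 0\<close>, so that
  \<open>F\<^sub>k\<^sub>+\<^sub>1 = s K' K\<^sup>k\<close>, which is \<open>s / (k + 1)\<close> times the derivative of \<open>K\<^sup>k\<^sup>+\<^sup>1\<close>. The coefficients of
  \<open>K\<^sup>k\<^sup>+\<^sup>1\<close> are convolutions of binomial coefficients, symmetric in \<open>a\<close> and \<open>b\<close>; multiplied by
  \<open>a\<^sup>n + b\<^sup>n\<close> they become combinations of \<open>a\<^sup>j b\<^sup>2\<^sup>n\<^sup>-\<^sup>k\<^sup>-\<^sup>j + a\<^sup>2\<^sup>n\<^sup>-\<^sup>k\<^sup>-\<^sup>j b\<^sup>j\<close>, as in \<open>G\<close>.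
\<close>

unbundle fps_syntax

fun lucas_poly :: "'a :: comm_ring_1 \<Rightarrow> 'a \<Rightarrow> nat \<Rightarrow> 'a poly" where
  "lucas_poly a b 0 = 2"
| "lucas_poly a b (Suc 0) = [:- (a + b), 1:]"
| "lucas_poly a b (Suc (Suc n)) =
     [:- (a + b), 1:] * lucas_poly a b (Suc n) - smult (a * b) (lucas_poly a b n)"

lemma coeff_lucas_poly_Suc_Suc_0:
  "coeff (lucas_poly a b (Suc (Suc n))) 0 =
     - (a + b) * coeff (lucas_poly a b (Suc n)) 0 - a * b * coeff (lucas_poly a b n) 0"
  by (simp add: algebra_simps)

lemma coeff_lucas_poly_Suc_Suc_Suc:
  "coeff (lucas_poly a b (Suc (Suc n))) (Suc k) = coeff (lucas_poly a b (Suc n)) k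
     - (a + b) * coeff (lucas_poly a b (Suc n)) (Suc k) - a * b * coeff (lucas_poly a b n) (Suc k)"
  by (simp add: algebra_simps)

lemma coeff_lucas_poly_0: "coeff (lucas_poly a b n) 0 = (- 1) ^ n * (a ^ n + b ^ n)"
proof (induction n rule: induct_nat_012)
  case (ge2 n)
  show ?case
    unfolding coeff_lucas_poly_Suc_Suc_0 ge2 by (simp add: algebra_simps)
qed (simp_all add: numeral_poly)

definition lucas_series :: "'a :: comm_ring_1 \<Rightarrow> 'a \<Rightarrow> nat \<Rightarrow> 'a fps" where
  "lucas_series a b k = Abs_fps (\<lambda>n. (- 1) ^ (n + k) * coeff (lucas_poly a b n) k)"

lemma coeff_lucas_poly: "coeff (lucas_poly a b n) k = (- 1) ^ (n + k) * lucas_series a b k $ n"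
  by (simp add: lucas_series_def flip: mult.assoc power_mult_distrib)

definition lucas_denom :: "'a :: comm_ring_1 \<Rightarrow> 'a \<Rightarrow> 'a fps" where
  "lucas_denom a b = (1 - fps_const a * fps_X) * (1 - fps_const b * fps_X)"

lemma lucas_denom_expand:
  "lucas_denom a b = 1 - fps_const (a + b) * fps_X + fps_const (a * b) * fps_X ^ 2"
  by (simp add: lucas_denom_def algebra_simps power2_eq_square
      flip: fps_const_add fps_const_mult)

lemma lucas_denom_commute: "lucas_denom a b = lucas_denom b a"
  by (simp add: lucas_denom_def mult.commute)

lemma lucas_denom_nth_0: "lucas_denom a b $ 0 = 1"
  by (simp add: lucas_denom_def)

lemma lucas_denom_nonzero: "lucas_denom a b \<noteq> 0"
  using lucas_denom_nth_0[of a b] by auto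

lemma mult_lucas_denom_eq_iff:
  "f * lucas_denom a b = g \<longleftrightarrow>
     f $ 0 = g $ 0 \<and> f $ 1 - (a + b) * f $ 0 = g $ 1 \<and>
     (\<forall>n. f $ Suc (Suc n) - (a + b) * f $ Suc n + a * b * f $ n = g $ Suc (Suc n))"
proof -
  have expand: "f * lucas_denom a b =
      f - fps_const (a + b) * (fps_X * f) + fps_const (a * b) * (fps_X ^ 2 * f)"
    unfolding lucas_denom_expand by (simp add: algebra_simps)
  have split: "(\<forall>n. P n) \<longleftrightarrow> P 0 \<and> P 1 \<and> (\<forall>n. P (Suc (Suc n)))" for P :: "nat \<Rightarrow> bool"
    using induct_nat_012[of P] by auto
  show ?thesis
    unfolding fps_eq_iff split[of "\<lambda>n. _ $ n = _ $ n"] expand by (simp add: fps_X_power_mult_nth)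
qed

lemma lucas_series_0_mult_denom:
  "lucas_series a b 0 * lucas_denom a b = 2 - fps_const (a + b) * fps_X"
  unfolding mult_lucas_denom_eq_iff
  by (auto simp: lucas_series_def coeff_lucas_poly_0 algebra_simps fps_numeral_nth)

lemma lucas_series_Suc_mult_denom:
  "lucas_series a b (Suc k) * lucas_denom a b = fps_X * (lucas_series a b k - of_bool (k = 0))"
  unfolding mult_lucas_denom_eq_iff
  by (cases k) (simp_all add: lucas_series_def coeff_lucas_poly_Suc_Suc_Suc numeral_poly
      algebra_simps del: lucas_poly.simps(3))

definition lucas_kernel :: "'a :: field \<Rightarrow> 'a \<Rightarrow> 'a fps" where
  "lucas_kernel a b = fps_X * inverse (lucas_denom a b)"

lemma lucas_kernel_commute: "lucas_kernel a b = lucas_kernel b a"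
  by (simp add: lucas_kernel_def lucas_denom_commute)

lemma lucas_kernel_mult_denom: "lucas_kernel a b * lucas_denom a b = fps_X"
  by (simp add: lucas_kernel_def mult.assoc inverse_mult_eq_1 lucas_denom_nth_0)

lemma fps_deriv_lucas_kernel:
  "fps_deriv (lucas_kernel a b) * lucas_denom a b = lucas_series a b 0 - 1"
proof -
  let ?D = "lucas_denom a b" and ?K = "lucas_kernel a b"
  have "fps_deriv ?K * ?D = 1 - ?K * fps_deriv ?D"
    using arg_cong[OF lucas_kernel_mult_denom, of fps_deriv a b] by (simp add: algebra_simps)
  then have "fps_deriv ?K * ?D * ?D = (1 - ?K * fps_deriv ?D) * ?D"
    by simp
  also have "\<dots> = ?D - (?K * ?D) * fps_deriv ?D"
    by (simp add: algebra_simps)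
  also have "\<dots> = 1 - fps_const (a * b) * fps_X ^ 2"
    unfolding lucas_kernel_mult_denom unfolding lucas_denom_expand
    by (simp add: algebra_simps power2_eq_square)
  also have "\<dots> = (lucas_series a b 0 - 1) * ?D"
    unfolding left_diff_distrib lucas_series_0_mult_denom unfolding lucas_denom_expand by simp
  finally show ?thesis
    using lucas_denom_nonzero[of a b] by simp
qed

lemma lucas_series_Suc:
  "lucas_series a b (Suc k) = fps_X * fps_deriv (lucas_kernel a b) * lucas_kernel a b ^ k"
proof (induction k)
  case 0
  have "lucas_series a b (Suc 0) * lucas_denom a b =
      fps_X * fps_deriv (lucas_kernel a b) * lucas_denom a b"
    unfolding lucas_series_Suc_mult_denom mult.assoc fps_deriv_lucas_kernel by simp
  then show ?case
    using lucas_denom_nonzero[of a b] by simp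
next
  case (Suc k)
  have "lucas_series a b (Suc (Suc k)) * lucas_denom a b =
      fps_X * fps_deriv (lucas_kernel a b) * lucas_kernel a b ^ k
        * (lucas_kernel a b * lucas_denom a b)"
    unfolding lucas_series_Suc_mult_denom lucas_kernel_mult_denom Suc by simp
  then show ?case
    using lucas_denom_nonzero[of a b] by (simp flip: mult.assoc)
qed

lemma lucas_series_Suc_nth:
  "of_nat (Suc k) * lucas_series a b (Suc k) $ n = of_nat n * lucas_kernel a b ^ Suc k $ n"
proof -
  have "of_nat (Suc k) * lucas_series a b (Suc k) = fps_X * fps_deriv (lucas_kernel a b ^ Suc k)"
    unfolding lucas_series_Suc fps_deriv_power' by (simp add: mult_ac)
  from arg_cong[OF this, of "\<lambda>f. f $ n"] show ?thesis
    by (cases n) (simp_all add: fps_mult_of_nat_nth del: power_Suc of_nat_Suc)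
qed

lemma inverse_one_minus_fps_X_power_nth:
  fixes a :: "'a :: field_char_0"
  shows "inverse ((1 - fps_const a * fps_X) ^ Suc k) $ n = of_nat ((n + k) choose k) * a ^ n"
  using binomial_symmetric[of n "n + k"]
  by (simp add: one_minus_const_fps_X_neg_power' add.commute del: power_Suc)

lemma lucas_kernel_power_nth_shift:
  "lucas_kernel a b ^ m $ n = (if n < m then 0 else
     (inverse ((1 - fps_const a * fps_X) ^ m) * inverse ((1 - fps_const b * fps_X) ^ m)) $ (n - m))"
  unfolding lucas_kernel_def lucas_denom_def power_mult_distrib fps_inverse_mult fps_inverse_power
  by (rule fps_X_power_mult_nth)

lemma lucas_kernel_power_nth:
  fixes a b :: "'a :: field_char_0"
  shows "lucas_kernel a b ^ Suc k $ n =
    (\<Sum>j<n - k. of_nat (((j + k) choose k) * ((n - Suc j) choose k))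
       * (a ^ j * b ^ (n - Suc k - j)))"
proof -
  let ?inv = "\<lambda>c. inverse ((1 - fps_const c * fps_X) ^ Suc k) :: 'a fps"
  show ?thesis
  proof (cases "n < Suc k")
    case True
    then show ?thesis
      unfolding lucas_kernel_power_nth_shift by simp
  next
    case False
    then have "n - k = Suc (n - Suc k)"
      by simp
    then have range: "{..<n - k} = {0..n - Suc k}"
      by (simp only: lessThan_Suc_atMost atMost_atLeast0)
    have "lucas_kernel a b ^ Suc k $ n = (\<Sum>j=0..n - Suc k. ?inv a $ j * ?inv b $ (n - Suc k - j))"
      unfolding lucas_kernel_power_nth_shift if_not_P[OF False] fps_mult_nth ..
    also have "\<dots> = (\<Sum>j=0..n - Suc k.
        of_nat (((j + k) choose k) * ((n - Suc j) choose k)) * (a ^ j * b ^ (n - Suc k - j)))"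
    proof (rule sum.cong[OF refl])
      fix j
      assume "j \<in> {0..n - Suc k}"
      then have index: "n - Suc k - j + k = n - Suc j"
        using False by auto
      show "?inv a $ j * ?inv b $ (n - Suc k - j) =
          of_nat (((j + k) choose k) * ((n - Suc j) choose k)) * (a ^ j * b ^ (n - Suc k - j))"
        unfolding inverse_one_minus_fps_X_power_nth index of_nat_mult by (simp only: mult_ac)
    qed
    finally show ?thesis
      unfolding range .
  qed
qed

definition symmetrized_monomial :: "'a :: comm_semiring_1 \<Rightarrow> 'a \<Rightarrow> nat \<Rightarrow> nat \<Rightarrow> 'a" where
  "symmetrized_monomial a b i j = a ^ i * b ^ j + a ^ j * b ^ i"

lemma power_sum_mult_lucas_kernel_power_nth:
  fixes a b :: "'a :: field_char_0"
  shows "(a ^ r + b ^ r) * lucas_kernel a b ^ Suc k $ n =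
    (\<Sum>j<n - k. of_nat (((j + k) choose k) * ((n - Suc j) choose k))
       * symmetrized_monomial a b j (r + n - Suc k - j))"
proof -
  let ?c = "\<lambda>j. of_nat (((j + k) choose k) * ((n - Suc j) choose k)) :: 'a"
  have "(a ^ r + b ^ r) * lucas_kernel a b ^ Suc k $ n
      = b ^ r * lucas_kernel a b ^ Suc k $ n + a ^ r * lucas_kernel b a ^ Suc k $ n"
    unfolding lucas_kernel_commute[of b a] by (simp add: distrib_right)
  also have "\<dots> = (\<Sum>j<n - k. ?c j * symmetrized_monomial a b j (r + n - Suc k - j))"
    unfolding lucas_kernel_power_nth sum_distrib_left sum.distrib[symmetric]
  proof (rule sum.cong[OF refl])
    fix j
    assume "j \<in> {..<n - k}"
    then have exponent: "r + n - Suc k - j = r + (n - Suc k - j)"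
      by auto
    show "b ^ r * (?c j * (a ^ j * b ^ (n - Suc k - j)))
          + a ^ r * (?c j * (b ^ j * a ^ (n - Suc k - j)))
        = ?c j * symmetrized_monomial a b j (r + n - Suc k - j)"
      unfolding symmetrized_monomial_def exponent power_add by (simp only: distrib_left mult_ac)
  qed
  finally show ?thesis .
qed

definition lucas_pair :: "'a :: comm_ring_1 \<Rightarrow> 'a \<Rightarrow> nat \<Rightarrow> 'a poly" where
  "lucas_pair a b n = smult (a ^ n + b ^ n) (lucas_poly a b (Suc n))
     + smult (a ^ Suc n + b ^ Suc n) (lucas_poly a b n)"

lemma coeff_lucas_pair_0: "coeff (lucas_pair a b n) 0 = 0"
  unfolding lucas_pair_def coeff_add coeff_smult coeff_lucas_poly_0 by (simp add: mult_ac)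

lemma coeff_lucas_pair_Suc_kernel:
  fixes a b :: "'a :: field"
  shows "of_nat (Suc k) * coeff (lucas_pair a b n) (Suc k) = (- 1) ^ (n + k) *
    (of_nat (Suc n) * ((a ^ n + b ^ n) * lucas_kernel a b ^ Suc k $ Suc n)
     - of_nat n * ((a ^ Suc n + b ^ Suc n) * lucas_kernel a b ^ Suc k $ n))"
proof -
  have "of_nat (Suc k) * coeff (lucas_pair a b n) (Suc k) = (- 1) ^ (n + k) *
      ((a ^ n + b ^ n) * (of_nat (Suc k) * lucas_series a b (Suc k) $ Suc n)
       - (a ^ Suc n + b ^ Suc n) * (of_nat (Suc k) * lucas_series a b (Suc k) $ n))"
    unfolding lucas_pair_def coeff_add coeff_smult coeff_lucas_poly
    by (simp add: algebra_simps del: of_nat_Suc power_Suc) (simp add: algebra_simps)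
  then show ?thesis
    unfolding lucas_series_Suc_nth by (simp only: mult.left_commute)
qed

text \<open>
  The factor \<open>of_bool\<close> matters only for \<open>k = 0\<close>, where the truncated \<open>(n - Suc j) choose k\<close> is \<open>1\<close>
  even at \<open>j = n\<close>.
\<close>

lemma coeff_lucas_pair_Suc_symmetrized:
  fixes a b :: "'a :: field_char_0"
  assumes "k \<le> n"
  shows "of_nat (Suc k) * coeff (lucas_pair a b n) (Suc k) = (- 1) ^ (n + k) *
    (\<Sum>j\<le>n - k. of_nat ((j + k) choose k) *
       (of_nat (Suc n * ((n - j) choose k))
         - of_bool (j < n - k) * of_nat (n * ((n - Suc j) choose k)))
       * symmetrized_monomial a b j (2 * n - k - j))"
proof -
  let ?m = "\<lambda>j. symmetrized_monomial a b j (2 * n - k - j)"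
  have upper: "(a ^ n + b ^ n) * lucas_kernel a b ^ Suc k $ Suc n
      = (\<Sum>j\<le>n - k. of_nat (((j + k) choose k) * ((n - j) choose k)) * ?m j)"
    unfolding power_sum_mult_lucas_kernel_power_nth
    using assms by (simp add: Suc_diff_le lessThan_Suc_atMost mult_2)
  have lower: "(a ^ Suc n + b ^ Suc n) * lucas_kernel a b ^ Suc k $ n
      = (\<Sum>j\<le>n - k. of_bool (j < n - k)
          * of_nat (((j + k) choose k) * ((n - Suc j) choose k)) * ?m j)"
    unfolding power_sum_mult_lucas_kernel_power_nth
    by (simp add: mult_2 flip: lessThan_Suc_atMost)
  have "of_nat (Suc n) * ((a ^ n + b ^ n) * lucas_kernel a b ^ Suc k $ Suc n)
      - of_nat n * ((a ^ Suc n + b ^ Suc n) * lucas_kernel a b ^ Suc k $ n)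
    = (\<Sum>j\<le>n - k. of_nat ((j + k) choose k) *
       (of_nat (Suc n * ((n - j) choose k))
         - of_bool (j < n - k) * of_nat (n * ((n - Suc j) choose k)))
       * ?m j)"
    unfolding upper lower sum_distrib_left sum_subtractf[symmetric]
    by (intro sum.cong) (simp_all add: algebra_simps)
  then show ?thesis
    unfolding coeff_lucas_pair_Suc_kernel by simp
qed

lemma coeff_lucas_pair_Suc_eq_0:
  fixes a b :: "'a :: field_char_0"
  assumes "n < k"
  shows "coeff (lucas_pair a b n) (Suc k) = 0"
  using assms coeff_lucas_pair_Suc_kernel[of k a b n]
  by (simp add: lucas_kernel_power_nth del: of_nat_Suc power_Suc)

lemma sum_atMost_double_fold:
  fixes f :: "nat \<Rightarrow> 'a :: comm_monoid_add"
  shows "(\<Sum>j\<le>2 * n. f j) = (\<Sum>j<n. f j + f (2 * n - j)) + f n"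
proof -
  have "(\<Sum>j\<le>2 * n. f j) = (\<Sum>j<n. f j) + f n + (\<Sum>j=Suc n..2 * n. f j)"
    unfolding mult_2 sum_up_index_split by (simp flip: lessThan_Suc_atMost)
  also have "(\<Sum>j=Suc n..2 * n. f j) = (\<Sum>j<n. f (2 * n - j))"
    by (rule sum.reindex_bij_witness[of _ "\<lambda>j. 2 * n - j" "\<lambda>j. 2 * n - j"]) auto
  finally show ?thesis
    by (simp add: sum.distrib add_ac)
qed

lemma coeff_lucas_pair_1:
  fixes a b :: "'a :: field_char_0"
  shows "coeff (lucas_pair a b n) 1 = (- 1) ^ n *
    (of_nat (2 * n + 1) * (a * b) ^ n + (\<Sum>j\<le>2 * n. a ^ (2 * n - j) * b ^ j))"
proof -
  let ?m = "\<lambda>j. symmetrized_monomial a b j (2 * n - j)"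
  have "coeff (lucas_pair a b n) 1 = (- 1) ^ n *
      (\<Sum>j\<le>n. (of_nat (Suc n) - of_bool (j < n) * of_nat n) * ?m j)"
    using coeff_lucas_pair_Suc_symmetrized[of 0 n a b] by simp
  also have "(\<Sum>j\<le>n. (of_nat (Suc n) - of_bool (j < n) * of_nat n) * ?m j)
      = (\<Sum>j<n. ?m j) + of_nat (Suc n) * ?m n"
    by (simp add: flip: lessThan_Suc_atMost)
  also have "\<dots> = of_nat (2 * n + 1) * (a * b) ^ n + (\<Sum>j\<le>2 * n. a ^ (2 * n - j) * b ^ j)"
    unfolding sum_atMost_double_fold
    by (simp add: symmetrized_monomial_def algebra_simps power_mult_distrib)
  finally show ?thesis .
qed

lemma binomial_weighted_difference:
  "of_nat (Suc n * (Suc i choose Suc l)) - of_nat (n * (i choose Suc l))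
     = (of_nat (i choose l) * of_nat (n * Suc l + Suc i) / of_nat (Suc l) :: 'a :: field_char_0)"
proof -
  have "Suc n * (Suc i choose Suc l) * Suc l
      = n * (i choose Suc l) * Suc l + (i choose l) * (n * Suc l + Suc i)"
    using Suc_times_binomial[of l i] by (simp add: algebra_simps)
  from arg_cong[OF this, of "of_nat :: nat \<Rightarrow> 'a"] show ?thesis
    using of_nat_neq_0[of l, where 'a = 'a]
    by (simp only: of_nat_mult of_nat_add eq_divide_eq left_diff_distrib) simp
qed

lemma binomial_weighted_difference_of_bool:
  assumes "0 < k" "k \<le> n" "j \<le> n - k"
  shows "of_nat (Suc n * ((n - j) choose k))
      - of_bool (j < n - k) * of_nat (n * ((n - Suc j) choose k))
    = (of_nat ((n - j - 1) choose (k - 1)) * (of_nat n * (of_nat k + 1) - of_nat j) / of_nat k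
       :: 'a :: field_char_0)"
proof -
  obtain l where k: "k = Suc l"
    using assms(1) by (cases k) auto
  have "j < n"
    using assms by linarith
  then obtain i where i: "n - j = Suc i"
    by (metis Suc_diff_Suc)
  then have pred: "n - Suc j = i"
    by simp
  have extended:
    "of_bool (j < n - k) * of_nat (n * ((n - Suc j) choose k)) = (of_nat (n * (i choose k)) :: 'a)"
    using assms(3) i pred by (auto simp: binomial_eq_0)
  have "n = Suc i + j"
    using i by simp
  then have "of_nat n = (of_nat (Suc i + j) :: 'a)"
    by (rule arg_cong)
  then have numerator: "of_nat n * (of_nat k + 1) - of_nat j = (of_nat (n * Suc l + Suc i) :: 'a)"
    unfolding k by (simp add: algebra_simps)
  show ?thesis
    unfolding extended numerator i unfolding k binomial_weighted_difference by simp
qed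

lemma coeff_lucas_pair_Suc_binomial:
  fixes a b :: "'a :: field_char_0"
  assumes "0 < k" "k \<le> n"
  shows "coeff (lucas_pair a b n) (Suc k) = (- 1) ^ (n + k) *
    (\<Sum>j\<le>n - k. of_nat ((j + k) choose k) * of_nat ((n - j - 1) choose (k - 1))
       * (of_nat n * (of_nat k + 1) - of_nat j) / (of_nat k * (of_nat k + 1))
       * symmetrized_monomial a b j (2 * n - k - j))"
proof -
  let ?w = "\<lambda>j. of_nat ((n - j - 1) choose (k - 1))
      * (of_nat n * (of_nat k + 1) - of_nat j) / of_nat k :: 'a"
  let ?m = "\<lambda>j. symmetrized_monomial a b j (2 * n - k - j)"
  have "of_nat (Suc k) * coeff (lucas_pair a b n) (Suc k) = (- 1) ^ (n + k) *
      (\<Sum>j\<le>n - k. of_nat ((j + k) choose k) * ?w j * ?m j)"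
    unfolding coeff_lucas_pair_Suc_symmetrized[OF assms(2)]
    by (intro arg_cong2[where f = "(*)"] sum.cong refl
        binomial_weighted_difference_of_bool assms) simp
  then have "coeff (lucas_pair a b n) (Suc k) = (- 1) ^ (n + k) *
      ((\<Sum>j\<le>n - k. of_nat ((j + k) choose k) * ?w j * ?m j) / of_nat (Suc k))"
    by (simp add: eq_divide_eq mult.commute del: of_nat_Suc)
  then show ?thesis
    unfolding sum_divide_distrib by (simp add: mult_ac add.commute)
qed

lemma coeff_lucas_pair_tvar:
  "coeff (lucas_pair 1 tvar n) (Suc k) = (if k \<le> n then (- 1) ^ (n - k) * G n k else 0)"
proof (cases "k \<le> n")
  case True
  then have sign: "(- 1 :: ratfun) ^ (n + k) = (- 1) ^ (n - k)"
    by (simp add: minus_one_power_iff)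
  show ?thesis
  proof (cases "k = 0")
    case True
    then show ?thesis
      using coeff_lucas_pair_1[of 1 tvar n] by (simp add: G_def)
  next
    case False
    then show ?thesis
      using \<open>k \<le> n\<close> coeff_lucas_pair_Suc_binomial[of k n 1 tvar] unfolding sign
      by (simp add: G_def symmetrized_monomial_def atMost_atLeast0 add.commute)
  qed
qed (simp add: coeff_lucas_pair_Suc_eq_0)

lemma lucas_pair_tvar:
  "lucas_pair 1 tvar n = [:0, 1:] * (\<Sum>k=0..n. monom ((- 1) ^ (n - k) * G n k) k)"
proof (rule poly_eqI)
  fix i
  show "coeff (lucas_pair 1 tvar n) i =
      coeff ([:0, 1:] * (\<Sum>k=0..n. monom ((- 1) ^ (n - k) * G n k) k)) i"
    by (cases i) (simp_all add: coeff_lucas_pair_0 coeff_lucas_pair_tvar coeff_sum)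
qed

lemma tvar_pos: "tvar > 0"
  unfolding tvar_def by (simp add: zero_less_Fract_iff less_poly_def pos_poly_def)

lemma one_plus_tvar_power_nonzero: "1 + tvar ^ n \<noteq> 0"
  using zero_less_power[OF tvar_pos, of n] by (simp add: add_pos_pos less_imp_neq[symmetric])

lemma tau_even: "0 < n \<Longrightarrow> tau (2 * n) = (1 + tvar ^ Suc n) / (1 + tvar ^ n)"
  by (simp add: tau_def Let_def)

lemma tau_odd: "tau (Suc (2 * n)) = tvar * (1 + tvar ^ n) / (1 + tvar ^ Suc n)"
  by (simp add: tau_def Let_def)

lemma tau_odd_add_tau_even: "tau (Suc (2 * n)) + tau (2 * Suc n) = 1 + tvar"
  unfolding tau_odd tau_even[OF zero_less_Suc]
  using one_plus_tvar_power_nonzero[of "Suc n"]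
  by (simp add: divide_simps) (simp add: algebra_simps)

lemma tau_odd_mult_ratio: "tau (Suc (2 * n)) * ((1 + tvar ^ Suc n) / (1 + tvar ^ n)) = tvar"
  unfolding tau_odd using one_plus_tvar_power_nonzero[of "Suc n"] one_plus_tvar_power_nonzero[of n]
  by simp

lemma L_contracted_recurrence:
  "L (Suc (Suc (Suc (Suc m)))) =
     ([:0, 1:] ^ 2 - [:tau (Suc m) + tau (Suc (Suc m)):]) * L (Suc (Suc m))
     - smult (tau (Suc m) * tau m) (L m)"
proof -
  let ?X = "[:0, 1:] :: ratfun poly"
  have X_mult: "?X * L (Suc m) = L (Suc (Suc m)) + smult (tau m) (L m)"
    by simp
  have "L (Suc (Suc (Suc (Suc m)))) =
      ?X * (?X * L (Suc (Suc m)) - smult (tau (Suc m)) (L (Suc m)))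
      - smult (tau (Suc (Suc m))) (L (Suc (Suc m)))"
    by (simp only: L.simps(3)[of "Suc (Suc m)"] L.simps(3)[of "Suc m"])
  also have "\<dots> = ?X ^ 2 * L (Suc (Suc m)) - smult (tau (Suc m)) (?X * L (Suc m))
      - smult (tau (Suc (Suc m))) (L (Suc (Suc m)))"
    by (simp only: right_diff_distrib mult_smult_right power2_eq_square mult.assoc)
  also have "\<dots> = (?X ^ 2 - [:tau (Suc m) + tau (Suc (Suc m)):]) * L (Suc (Suc m))
      - smult (tau (Suc m) * tau m) (L m)"
    unfolding X_mult
    by (simp add: left_diff_distrib smult_add_left smult_add_right del: L.simps)
  finally show ?thesis .
qed

text \<open>
  The exceptional value of \<open>\<tau>\<^sub>0\<close> makes up for \<open>L\<^sub>0 = 1\<close> while \<open>V\<^sub>0 = 2\<close>.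
\<close>

lemma smult_tau_L_even:
  assumes "0 < n \<Longrightarrow> L (2 * n) = lucas_poly 1 tvar n \<circ>\<^sub>p [:0, 1:] ^ 2"
  shows "smult (tau (2 * n)) (L (2 * n)) =
    smult ((1 + tvar ^ Suc n) / (1 + tvar ^ n)) (lucas_poly 1 tvar n) \<circ>\<^sub>p [:0, 1:] ^ 2"
proof (cases "n = 0")
  case True
  then show ?thesis
    by (simp add: tau_def pcompose_smult numeral_poly)
next
  case False
  then show ?thesis
    by (simp add: assms tau_even pcompose_smult)
qed

lemma L_even: "0 < n \<Longrightarrow> L (2 * n) = lucas_poly 1 tvar n \<circ>\<^sub>p [:0, 1:] ^ 2"
proof (induction n rule: induct_nat_012)
  case 1
  show ?case
    by (simp add: tau_def pcompose_pCons numeral_2_eq_2)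
next
  case (ge2 n)
  let ?X = "[:0, 1:] :: ratfun poly" and ?V = "lucas_poly 1 tvar"
  have linear: "[:- (1 + tvar), 1:] \<circ>\<^sub>p ?X ^ 2 = ?X ^ 2 - [:1 + tvar:]"
    by (simp add: pcompose_pCons)
  have "smult (tau (2 * n)) (L (2 * n)) =
      smult ((1 + tvar ^ Suc n) / (1 + tvar ^ n)) (?V n) \<circ>\<^sub>p ?X ^ 2"
    by (rule smult_tau_L_even) (rule ge2.IH(1))
  then have "smult (tau (Suc (2 * n)) * tau (2 * n)) (L (2 * n)) = smult tvar (?V n \<circ>\<^sub>p ?X ^ 2)"
    unfolding smult_smult[symmetric] by (simp only: pcompose_smult smult_smult tau_odd_mult_ratio)
  moreover have "L (2 * Suc (Suc n)) =
      (?X ^ 2 - [:tau (Suc (2 * n)) + tau (2 * Suc n):]) * L (2 * Suc n)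
      - smult (tau (Suc (2 * n)) * tau (2 * n)) (L (2 * n))"
    using L_contracted_recurrence[of "2 * n"] by (simp del: L.simps)
  ultimately have "L (2 * Suc (Suc n)) = (?X ^ 2 - [:1 + tvar:]) * (?V (Suc n) \<circ>\<^sub>p ?X ^ 2)
      - smult tvar (?V n \<circ>\<^sub>p ?X ^ 2)"
    unfolding tau_odd_add_tau_even ge2.IH(2)[OF zero_less_Suc] by simp
  also have "\<dots> = ?V (Suc (Suc n)) \<circ>\<^sub>p ?X ^ 2"
    unfolding lucas_poly.simps pcompose_diff pcompose_mult pcompose_smult linear by simp
  finally show ?case .
qed simp

lemma X_mult_L_odd:
  "[:0, 1:] * L (2 * n + 1) = smult (1 / (1 + tvar ^ n)) (lucas_pair 1 tvar n) \<circ>\<^sub>p [:0, 1:] ^ 2"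
proof -
  have "[:0, 1:] * L (2 * n + 1) = L (2 * Suc n) + smult (tau (2 * n)) (L (2 * n))"
    by simp
  also have "\<dots> = (lucas_poly 1 tvar (Suc n)
      + smult ((1 + tvar ^ Suc n) / (1 + tvar ^ n)) (lucas_poly 1 tvar n)) \<circ>\<^sub>p [:0, 1:] ^ 2"
    unfolding pcompose_add L_even[OF zero_less_Suc] using L_even by (simp only: smult_tau_L_even)
  also have "lucas_poly 1 tvar (Suc n)
      + smult ((1 + tvar ^ Suc n) / (1 + tvar ^ n)) (lucas_poly 1 tvar n)
      = smult (1 / (1 + tvar ^ n)) (lucas_pair 1 tvar n)"
    using one_plus_tvar_power_nonzero[of n]
    by (simp add: lucas_pair_def smult_add_right del: lucas_poly.simps)
  finally show ?thesis .
qed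

theorem theorem3:
  fixes n :: nat
  shows "S n = smult (1 / (1 + tvar ^ n))
                 (\<Sum>k=0..n. monom ((-1) ^ (n - k) * G n k) k)"
proof -
  let ?X = "[:0, 1:] :: ratfun poly"
  let ?P = "smult (1 / (1 + tvar ^ n)) (\<Sum>k=0..n. monom ((- 1) ^ (n - k) * G n k) k)"
  have "?X * L (2 * n + 1) = (?X * ?P) \<circ>\<^sub>p ?X ^ 2"
    unfolding X_mult_L_odd lucas_pair_tvar by simp
  also have "\<dots> = ?X * (?X * ?P \<circ>\<^sub>p ?X ^ 2)"
    unfolding pcompose_mult by (simp add: pcompose_pCons power2_eq_square mult.assoc)
  finally have "?X * ?P \<circ>\<^sub>p ?X ^ 2 = L (2 * n + 1)"
    by (rule mult_left_cancel[THEN iffD1, symmetric, rotated]) simp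
  then show ?thesis
    unfolding S_def by (rule the1_equality[OF S_unique_existence])
qed

end
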